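(* Let $\underline w=s_{i_1}\cdots s_{i_\ell}$ be a reduced expression of an element $w$ of the Weyl group $W$ of a symmetrizable Kac–Moody algebra. Then the cellular crystal $\mathbf B_{\underline w}=B_{i_1}\otimes\cdots\otimes B_{i_\ell}$ is connected.
   Context: Cartan datum: a symmetrizable generalized Cartan matrix $(\langle h_i,\alpha_j\rangle)_{i,j\in I}$, a free abelian group $P$ (weight lattice), simple roots $\alpha_i\in P$, simple coroots $h_i\in\mathrm{Hom}(P,\mathbb Z)$, a symmetric $\mathbb Q$-valued bilinear form on $P$ with $(\alpha_i,\alpha_i)\in2\mathbb Z_{>0}$ and $\langle h_i,\lambda\rangle=2(\alpha_i,\lambda)/(\alpha_i,\alpha_i)$, and $\Lambda_i\in P$ with $\langle h_j,\Lambda_i\rangle=\delta_{ij}$. $W\subset\mathrm{Aut}(P)$ is generated by $s_i(\lambda)=\lambda-\langle h_i,\lambda\rangle\alpha_i$. A crystal is a set $B$ with maps $\mathrm{wt}:B\to P$, $\varepsilon_i,\varphi_i:B\to\mathbb Z\sqcup\{-\infty\}$, $\tilde e_i,\tilde f_i:B\sqcup\{0\}\to B\sqcup\{0\}$ ($i\in I$) satisfying Kashiwara's axioms (in particular $\varphi_i(b)=\varepsilon_i(b)+\langle h_i,\mathrm{wt}(b)\rangle$ and $\tilde f_ib=b'\iff b=\tilde e_ib'$). Its crystal graph is the $I$-coloured oriented graph with vertex set $B$ and arrows $b\xrightarrow{i}b'$ iff $\tilde f_ib=b'$. $B$ is connected if this graph is connected (ignoring orientation). For $i\in I$, $B_i=\{(n)_i: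 n\in\mathbb Z\}$ with $\mathrm{wt}((n)_i)=n\alpha_i$, $\varepsilon_i((n)_i)=-n$, $\varphi_i((n)_i)=n$, $\tilde e_i(n)_i=(n+1)_i$, $\tilde f_i(n)_i=(n-1)_i$, and for $j\neq i$: $\varepsilon_j((n)_i)=\varphi_j((n)_i)=-\infty$, $\tilde e_j(n)_i=\tilde f_j(n)_i=0$. The tensor product $B_1\otimes B_2$ of crystals is $B_1\times B_2$ (elements written $b_1\otimes b_2$, with $b_1\otimes0=0\otimes b_2=0$) with $\mathrm{wt}(b_1\otimes b_2)=\mathrm{wt}(b_1)+\mathrm{wt}(b_2)$, $\varepsilon_i(b_1\otimes b_2)=\max(\varepsilon_i(b_1),\varepsilon_i(b_2)-\langle h_i,\mathrm{wt}(b_1)\rangle)$, $\varphi_i(b_1\otimes b_2)=\max(\varphi_i(b_2),\varphi_i(b_1)+\langle h_i,\mathrm{wt}(b_2)\rangle)$, $\tilde e_i(b_1\otimes b_2)=\tilde e_ib_1\otimes b_2$ if $\varphi_i(b_1)\ge\varepsilon_i(b_2)$ and $b_1\otimes\tilde e_ib_2$ if $\varphi_i(b_1)<\varepsilon_i(b_2)$, $\tilde f_i(b_1\otimes b_2)=\tilde f_ib_1\otimes b_2$ if $\varphi_i(b_1)>\varepsilon_i(b_2)$ and $b_1\otimes\tilde f_ib_2$ if $\varphi_i(b_1)\le\varepsilon_i(b_2)$. *)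

theory Defs
  imports Complex_Main "HOL-Library.Option_ord" "HOL-Algebra.Bij" "HOL-Algebra.Generated_Groups"
begin

definition generalized_cartan_matrix :: "'i set \<Rightarrow> ('i \<Rightarrow> 'i \<Rightarrow> int) \<Rightarrow> bool" where
  "generalized_cartan_matrix I A \<longleftrightarrow>
     (\<forall>i\<in>I. A i i = 2) \<and>
     (\<forall>i\<in>I. \<forall>j\<in>I. i \<noteq> j \<longrightarrow> A i j \<le> 0) \<and>
     (\<forall>i\<in>I. \<forall>j\<in>I. A i j = 0 \<longleftrightarrow> A j i = 0)"

definition symmetrizable :: "'i set \<Rightarrow> ('i \<Rightarrow> 'i \<Rightarrow> int) \<Rightarrow> bool" where
  "symmetrizable I A \<longleftrightarrow>
     (\<exists>d :: 'i \<Rightarrow> rat. (\<forall>i\<in>I. d i > 0) \<and>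
        (\<forall>i\<in>I. \<forall>j\<in>I. d i * of_int (A i j) = d j * of_int (A j i)))"

text \<open>The weight lattice \<open>P\<close> is the whole type \<open>'p\<close>. The field \<open>zscale\<close> is its multiplication by
  integers, which \<open>cartan_datum\<close> below forces to be the usual one (an abelian group has exactly one
  \<open>\<int>\<close>-module structure). \<open>coroot D i x\<close> is \<open>\<langle>h\<^sub>i, x\<rangle>\<close>. Indexed families matter only on \<open>index D\<close>.\<close>

record ('i, 'p) cartan_datum =
  index  :: "'i set"
  zscale :: "int \<Rightarrow> 'p \<Rightarrow> 'p"
  simple_root :: "'i \<Rightarrow> 'p"
  coroot :: "'i \<Rightarrow> 'p \<Rightarrow> int"
  form   :: "'p \<Rightarrow> 'p \<Rightarrow> rat"
  fund   :: "'i \<Rightarrow> 'p"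

definition cartan_matrix :: "('i, 'p) cartan_datum \<Rightarrow> 'i \<Rightarrow> 'i \<Rightarrow> int" where
  "cartan_matrix D i j = coroot D i (simple_root D j)"

definition cartan_datum :: "('i, 'p :: ab_group_add) cartan_datum \<Rightarrow> bool" where
  "cartan_datum D \<longleftrightarrow>
     module (zscale D) \<and>
     (\<exists>X. \<not> module.dependent (zscale D) X \<and> module.span (zscale D) X = UNIV) \<and>
     generalized_cartan_matrix (index D) (cartan_matrix D) \<and>
     symmetrizable (index D) (cartan_matrix D) \<and>
     (\<forall>i\<in>index D. additive (coroot D i)) \<and>
     (\<forall>x y. form D x y = form D y x) \<and>
     (\<forall>x. additive (form D x)) \<and>
     (\<forall>i\<in>index D. \<exists>m::int. m > 0 \<and> form D (simple_root D i) (simple_root D i) = 2 * of_int m) \<and>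
     (\<forall>i\<in>index D. \<forall>x. of_int (coroot D i x) =
        2 * form D (simple_root D i) x / form D (simple_root D i) (simple_root D i)) \<and>
     (\<forall>i\<in>index D. \<forall>j\<in>index D. coroot D j (fund D i) = (if i = j then 1 else 0))"

definition simple_reflection :: "('i, 'p :: ab_group_add) cartan_datum \<Rightarrow> 'i \<Rightarrow> 'p \<Rightarrow> 'p" where
  "simple_reflection D i x = x - zscale D (coroot D i x) (simple_root D i)"

definition weyl_group :: "('i, 'p :: ab_group_add) cartan_datum \<Rightarrow> ('p \<Rightarrow> 'p) set" where
  "weyl_group D =
     generate (AutoGroup \<lparr>carrier = (UNIV :: 'p set), mult = (+), one = 0\<rparr>)
       (simple_reflection D ` index D)"

definition word_prod :: "('i, 'p :: ab_group_add) cartan_datum \<Rightarrow> 'i list \<Rightarrow> 'p \<Rightarrow> 'p" where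
  "word_prod D ws = foldr (\<lambda>i g. simple_reflection D i \<circ> g) ws id"

definition reduced_expression ::
    "('i, 'p :: ab_group_add) cartan_datum \<Rightarrow> 'i list \<Rightarrow> ('p \<Rightarrow> 'p) \<Rightarrow> bool" where
  "reduced_expression D ws w \<longleftrightarrow>
     set ws \<subseteq> index D \<and> word_prod D ws = w \<and>
     (\<forall>vs. set vs \<subseteq> index D \<and> word_prod D vs = w \<longrightarrow> length ws \<le> length vs)"

text \<open>In \<open>int option\<close>, \<open>None\<close> is \<open>-\<infinity>\<close>: it is the least element of the order of
  \<^theory>\<open>HOL-Library.Option_ord\<close>. In the codomain of the crystal operators, \<open>None\<close> is the extra
  element \<open>0\<close>; the operators are given on \<open>B\<close> only, since they map \<open>0\<close> to \<open>0\<close>.\<close>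

record ('i, 'p, 'b) crystal = "'b partial_object" +
  wt  :: "'b \<Rightarrow> 'p"
  eps :: "'i \<Rightarrow> 'b \<Rightarrow> int option"
  phi :: "'i \<Rightarrow> 'b \<Rightarrow> int option"
  e_op :: "'i \<Rightarrow> 'b \<Rightarrow> 'b option"
  f_op :: "'i \<Rightarrow> 'b \<Rightarrow> 'b option"

definition shift :: "int \<Rightarrow> int option \<Rightarrow> int option" where
  "shift k = map_option (\<lambda>n. n + k)"

definition crystal :: "('i, 'p :: ab_group_add) cartan_datum \<Rightarrow> ('i, 'p, 'b) crystal \<Rightarrow> bool" where
  "crystal D B \<longleftrightarrow> (\<forall>i\<in>index D. \<forall>b\<in>carrier B.
     phi B i b = shift (coroot D i (wt B b)) (eps B i b) \<and>
     (\<forall>b'. e_op B i b = Some b' \<longrightarrow> b' \<in> carrier B \<and>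
        wt B b' = wt B b + simple_root D i \<and>
        eps B i b' = shift (-1) (eps B i b) \<and> phi B i b' = shift 1 (phi B i b)) \<and>
     (\<forall>b'. f_op B i b = Some b' \<longrightarrow> b' \<in> carrier B \<and>
        wt B b' = wt B b - simple_root D i \<and>
        eps B i b' = shift 1 (eps B i b) \<and> phi B i b' = shift (-1) (phi B i b)) \<and>
     (\<forall>b'\<in>carrier B. f_op B i b = Some b' \<longleftrightarrow> e_op B i b' = Some b) \<and>
     (phi B i b = None \<longrightarrow> e_op B i b = None \<and> f_op B i b = None))"

text \<open>\<open>(b, i, b')\<close> is the arrow of colour \<open>i\<close> from \<open>b\<close> to \<open>b'\<close>.\<close>

definition crystal_arrows ::
    "('i, 'p) cartan_datum \<Rightarrow> ('i, 'p, 'b) crystal \<Rightarrow> ('b \<times> 'i \<times> 'b) set" where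
  "crystal_arrows D B =
     {(b, i, b'). b \<in> carrier B \<and> b' \<in> carrier B \<and> i \<in> index D \<and> f_op B i b = Some b'}"

definition crystal_connected :: "('i, 'p) cartan_datum \<Rightarrow> ('i, 'p, 'b) crystal \<Rightarrow> bool" where
  "crystal_connected D B \<longleftrightarrow>
     (let E = {(b, b'). \<exists>i. (b, i, b') \<in> crystal_arrows D B}
      in \<forall>b\<in>carrier B. \<forall>b'\<in>carrier B. (b, b') \<in> (E \<union> E\<inverse>)\<^sup>*)"

text \<open>The crystal \<open>B\<^sub>i\<close>, with \<open>(n)\<^sub>i\<close> represented by the integer \<open>n\<close>.\<close>

definition elementary_crystal :: "('i, 'p) cartan_datum \<Rightarrow> 'i \<Rightarrow> ('i, 'p, int) crystal" where
  "elementary_crystal D i =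
     \<lparr>carrier = UNIV,
      wt = \<lambda>n. zscale D n (simple_root D i),
      eps = \<lambda>j n. if j = i then Some (- n) else None,
      phi = \<lambda>j n. if j = i then Some n else None,
      e_op = \<lambda>j n. if j = i then Some (n + 1) else None,
      f_op = \<lambda>j n. if j = i then Some (n - 1) else None\<rparr>"

definition tensor_crystal ::
    "('i, 'p :: ab_group_add) cartan_datum \<Rightarrow> ('i, 'p, 'b) crystal \<Rightarrow> ('i, 'p, 'c) crystal
      \<Rightarrow> ('i, 'p, 'b \<times> 'c) crystal" where
  "tensor_crystal D B C =
     \<lparr>carrier = carrier B \<times> carrier C,
      wt = \<lambda>(b, c). wt B b + wt C c,
      eps = \<lambda>i (b, c). max (eps B i b) (shift (- coroot D i (wt B b)) (eps C i c)),
      phi = \<lambda>i (b, c). max (phi C i c) (shift (coroot D i (wt C c)) (phi B i b)),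
      e_op = \<lambda>i (b, c). if phi B i b \<ge> eps C i c
               then map_option (\<lambda>b'. (b', c)) (e_op B i b)
               else map_option (\<lambda>c'. (b, c')) (e_op C i c),
      f_op = \<lambda>i (b, c). if phi B i b > eps C i c
               then map_option (\<lambda>b'. (b', c)) (f_op B i b)
               else map_option (\<lambda>c'. (b, c')) (f_op C i c)\<rparr>"

text \<open>Transport of structure along an injection \<open>g\<close>. It is used to let the iterated tensor products
  of all lengths live on one type, \<open>x\<^sub>1 \<otimes> \<dots> \<otimes> x\<^sub>l\<close> being the list \<open>[x\<^sub>1, \<dots>, x\<^sub>l]\<close>.\<close>

definition transport_crystal ::
    "('b \<Rightarrow> 'c) \<Rightarrow> ('i, 'p, 'b) crystal \<Rightarrow> ('i, 'p, 'c) crystal" where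
  "transport_crystal g B =
     \<lparr>carrier = g ` carrier B,
      wt = \<lambda>x. wt B (inv_into UNIV g x),
      eps = \<lambda>i x. eps B i (inv_into UNIV g x),
      phi = \<lambda>i x. phi B i (inv_into UNIV g x),
      e_op = \<lambda>i x. map_option g (e_op B i (inv_into UNIV g x)),
      f_op = \<lambda>i x. map_option g (f_op B i (inv_into UNIV g x))\<rparr>"

text \<open>The unit of the tensor product, the value of the empty product.\<close>

definition unit_crystal :: "'b \<Rightarrow> ('i, 'p :: ab_group_add, 'b) crystal" where
  "unit_crystal t =
     \<lparr>carrier = {t}, wt = \<lambda>_. 0, eps = \<lambda>_ _. None, phi = \<lambda>_ _. None,
      e_op = \<lambda>_ _. None, f_op = \<lambda>_ _. None\<rparr>"

fun cellular_crystal ::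
    "('i, 'p :: ab_group_add) cartan_datum \<Rightarrow> 'i list \<Rightarrow> ('i, 'p, int list) crystal" where
  "cellular_crystal D [] = unit_crystal []"
| "cellular_crystal D [i] = transport_crystal (\<lambda>n. [n]) (elementary_crystal D i)"
| "cellular_crystal D (i # j # ws) =
     transport_crystal (\<lambda>(n, ns). n # ns)
       (tensor_crystal D (elementary_crystal D i) (cellular_crystal D (j # ws)))"

lemma crystal_elementary:
  assumes "cartan_datum D" "i \<in> index D"
  shows "crystal D (elementary_crystal D i)"
proof -
  interpret m: module "zscale D" using assms by (simp add: cartan_datum_def)
  have add: "additive (coroot D i)" and two: "coroot D i (simple_root D i) = 2"
    using assms by (auto simp: cartan_datum_def generalized_cartan_matrix_def cartan_matrix_def)
  interpret a: additive "coroot D i" by (rule add)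
  have nat: "coroot D i (zscale D (int n) x) = int n * coroot D i x" for n x
    by (induction n) (auto simp: a.zero a.add m.scale_left_distrib algebra_simps)
  have "coroot D i (zscale D n x) = n * coroot D i x" for n x
  proof (cases n rule: int_cases2)
    case (nonneg k) then show ?thesis by (simp add: nat)
  next
    case (nonpos k) then show ?thesis by (simp add: nat a.minus)
  qed
  then show ?thesis
    using two by (auto simp: crystal_def elementary_crystal_def shift_def m.scale_left_distrib
        m.scale_left_diff_distrib)
qed

lemma crystalD:
  assumes "crystal D B" "i \<in> index D" "b \<in> carrier B"
  shows crystal_phi: "phi B i b = shift (coroot D i (wt B b)) (eps B i b)"
    and crystal_e: "e_op B i b = Some b' \<Longrightarrow> b' \<in> carrier B \<and> wt B b' = wt B b + simple_root D i \<and>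
        eps B i b' = shift (-1) (eps B i b) \<and> phi B i b' = shift 1 (phi B i b)"
    and crystal_f: "f_op B i b = Some b' \<Longrightarrow> b' \<in> carrier B \<and> wt B b' = wt B b - simple_root D i \<and>
        eps B i b' = shift 1 (eps B i b) \<and> phi B i b' = shift (-1) (phi B i b)"
    and crystal_fe: "b' \<in> carrier B \<Longrightarrow> f_op B i b = Some b' \<longleftrightarrow> e_op B i b' = Some b"
    and crystal_none: "phi B i b = None \<Longrightarrow> e_op B i b = None \<and> f_op B i b = None"
  using assms unfolding crystal_def by blast+

lemma crystal_tensor:
  assumes D: "cartan_datum D" and B: "crystal D B" and C: "crystal D C"
  shows "crystal D (tensor_crystal D B C)"
  unfolding crystal_def
proof (intro ballI)
  fix i x assume i: "i \<in> index D" and x: "x \<in> carrier (tensor_crystal D B C)"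
  have add: "additive (coroot D i)" and two: "coroot D i (simple_root D i) = 2"
    using D i by (auto simp: cartan_datum_def generalized_cartan_matrix_def cartan_matrix_def)
  interpret a: additive "coroot D i" by (rule add)
  obtain b c where bc: "x = (b, c)" "b \<in> carrier B" "c \<in> carrier C"
    using x by (auto simp: tensor_crystal_def)
  let ?T = "tensor_crystal D B C"
  note pB = crystal_phi[OF B i bc(2)] and pC = crystal_phi[OF C i bc(3)]
  have 1: "phi ?T i x = shift (coroot D i (wt ?T x)) (eps ?T i x)"
    unfolding bc tensor_crystal_def by (cases "eps B i b"; cases "eps C i c")
      (simp_all add: pB pC shift_def max_def a.add)
  have 2: "b' \<in> carrier ?T \<and> wt ?T b' = wt ?T x + simple_root D i \<and>
        eps ?T i b' = shift (-1) (eps ?T i x) \<and> phi ?T i b' = shift 1 (phi ?T i x)"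
    if e: "e_op ?T i x = Some b'" for b'
  proof (cases "phi B i b \<ge> eps C i c")
    case True
    then obtain b1 where b1: "e_op B i b = Some b1" "b' = (b1, c)"
      using e unfolding bc tensor_crystal_def by auto
    have "phi B i b \<noteq> None" using b1 crystal_none[OF B i bc(2)] by auto
    then show ?thesis using b1(2) True crystal_e[OF B i bc(2) b1(1)] bc(3)
      unfolding bc(1) pB tensor_crystal_def by (cases "eps B i b"; cases "eps C i c")
      (auto simp: pB pC shift_def max_def a.add two)
  next
    case False
    then obtain c1 where c1: "e_op C i c = Some c1" "b' = (b, c1)"
      using e unfolding bc tensor_crystal_def by auto
    show ?thesis using c1(2) False crystal_e[OF C i bc(3) c1(1)] bc(2)
      unfolding bc(1) pC tensor_crystal_def by (cases "eps B i b"; cases "eps C i c")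
      (auto simp: pB pC shift_def max_def a.add two)
  qed
  have 3: "b' \<in> carrier ?T \<and> wt ?T b' = wt ?T x - simple_root D i \<and>
        eps ?T i b' = shift 1 (eps ?T i x) \<and> phi ?T i b' = shift (-1) (phi ?T i x)"
    if f: "f_op ?T i x = Some b'" for b'
  proof (cases "phi B i b > eps C i c")
    case True
    then obtain b1 where b1: "f_op B i b = Some b1" "b' = (b1, c)"
      using f unfolding bc tensor_crystal_def by auto
    show ?thesis using b1(2) True crystal_f[OF B i bc(2) b1(1)] bc(3)
      unfolding bc(1) pB tensor_crystal_def by (cases "eps B i b"; cases "eps C i c")
      (auto simp: pB pC shift_def max_def a.diff a.add two)
  next
    case False
    then obtain c1 where c1: "f_op C i c = Some c1" "b' = (b, c1)"
      using f unfolding bc tensor_crystal_def by auto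
    have "phi C i c \<noteq> None" using c1 crystal_none[OF C i bc(3)] by auto
    then show ?thesis using c1(2) False crystal_f[OF C i bc(3) c1(1)] bc(2)
      unfolding bc(1) pC tensor_crystal_def by (cases "eps B i b"; cases "eps C i c")
      (auto simp: pB pC shift_def max_def a.diff a.add two)
  qed
  have 4: "f_op ?T i x = Some y \<longleftrightarrow> e_op ?T i y = Some x" if y0: "y \<in> carrier ?T" for y
  proof -
    obtain b' c' where y: "y = (b', c')" "b' \<in> carrier B" "c' \<in> carrier C"
      using y0 by (auto simp: tensor_crystal_def)
    have f: "f_op ?T i x = Some y \<longleftrightarrow>
        (if phi B i b > eps C i c then f_op B i b = Some b' \<and> c' = c else f_op C i c = Some c' \<and> b' = b)"
      unfolding bc y tensor_crystal_def by auto
    have e: "e_op ?T i y = Some x \<longleftrightarrow>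
        (if phi B i b' \<ge> eps C i c' then e_op B i b' = Some b \<and> c' = c else e_op C i c' = Some c \<and> b' = b)"
      unfolding bc y tensor_crystal_def by auto
    have fB: "f_op B i b = Some b' \<longleftrightarrow> e_op B i b' = Some b"
      by (rule crystal_fe[OF B i bc(2) y(2)])
    have fC: "f_op C i c = Some c' \<longleftrightarrow> e_op C i c' = Some c"
      by (rule crystal_fe[OF C i bc(3) y(3)])
    have gB: "phi B i b > eps C i c \<longleftrightarrow> phi B i b' \<ge> eps C i c" if "f_op B i b = Some b'"
    proof -
      have "phi B i b \<noteq> None" using that crystal_none[OF B i bc(2)] by auto
      then show ?thesis using crystal_f[OF B i bc(2) that]
        by (cases "phi B i b"; cases "eps C i c") (auto simp: shift_def)
    qed
    have gC: "phi B i b > eps C i c \<longleftrightarrow> phi B i b \<ge> eps C i c'" if "f_op C i c = Some c'"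
    proof -
      have "phi C i c \<noteq> None" using that crystal_none[OF C i bc(3)] by auto
      then have "eps C i c \<noteq> None" by (simp add: pC shift_def)
      then show ?thesis using crystal_f[OF C i bc(3) that]
        by (cases "phi B i b"; cases "eps C i c") (auto simp: shift_def)
    qed
    show ?thesis unfolding f e fB[symmetric] fC[symmetric] using gB gC by (auto split: if_splits)
  qed
  have 5: "e_op ?T i x = None \<and> f_op ?T i x = None" if p: "phi ?T i x = None"
  proof -
    have "max (phi C i c) (shift (coroot D i (wt C c)) (phi B i b)) = None"
      using p unfolding bc tensor_crystal_def by simp
    then have "phi B i b = None \<and> phi C i c = None"
      by (cases "phi B i b"; cases "phi C i c") (simp_all add: shift_def max_def split: if_splits)
    then show ?thesis
      using crystal_none[OF B i bc(2)] crystal_none[OF C i bc(3)]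
      unfolding bc tensor_crystal_def by simp
  qed
  show "phi ?T i x = shift (coroot D i (wt ?T x)) (eps ?T i x) \<and>
     (\<forall>b'. e_op ?T i x = Some b' \<longrightarrow> b' \<in> carrier ?T \<and>
        wt ?T b' = wt ?T x + simple_root D i \<and>
        eps ?T i b' = shift (-1) (eps ?T i x) \<and> phi ?T i b' = shift 1 (phi ?T i x)) \<and>
     (\<forall>b'. f_op ?T i x = Some b' \<longrightarrow> b' \<in> carrier ?T \<and>
        wt ?T b' = wt ?T x - simple_root D i \<and>
        eps ?T i b' = shift 1 (eps ?T i x) \<and> phi ?T i b' = shift (-1) (phi ?T i x)) \<and>
     (\<forall>b'\<in>carrier ?T. f_op ?T i x = Some b' \<longleftrightarrow> e_op ?T i b' = Some x) \<and>
     (phi ?T i x = None \<longrightarrow> e_op ?T i x = None \<and> f_op ?T i x = None)"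
    apply (intro conjI)
    subgoal by (rule 1)
    subgoal by (intro allI impI) (rule 2)
    subgoal by (intro allI impI) (rule 3)
    subgoal by (intro ballI) (rule 4)
    subgoal using 5 by (rule impI)
    done
qed

lemma crystal_transport:
  assumes B: "crystal D B" and g: "inj g"
  shows "crystal D (transport_crystal g B)"
proof -
  have [simp]: "inv_into UNIV g (g x) = x" for x using g by simp
  let ?T = "transport_crystal g B"
  have s: "carrier ?T = g ` carrier B" "wt ?T (g x) = wt B x"
    "eps ?T i (g x) = eps B i x" "phi ?T i (g x) = phi B i x"
    "e_op ?T i (g x) = map_option g (e_op B i x)" "f_op ?T i (g x) = map_option g (f_op B i x)" for i x
    by (simp_all add: transport_crystal_def)
  have so: "map_option g z = Some (g y) \<longleftrightarrow> z = Some y" for z y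
    using g by (cases z) (auto dest: injD)
  show ?thesis
    unfolding crystal_def s(1) ball_simps(9)
  proof (intro ballI)
    fix i b assume i: "i \<in> index D" and b: "b \<in> carrier B"
    note c = crystalD[OF B i b]
    show "phi ?T i (g b) = shift (coroot D i (wt ?T (g b))) (eps ?T i (g b)) \<and>
     (\<forall>b'. e_op ?T i (g b) = Some b' \<longrightarrow> b' \<in> g ` carrier B \<and>
        wt ?T b' = wt ?T (g b) + simple_root D i \<and>
        eps ?T i b' = shift (-1) (eps ?T i (g b)) \<and> phi ?T i b' = shift 1 (phi ?T i (g b))) \<and>
     (\<forall>b'. f_op ?T i (g b) = Some b' \<longrightarrow> b' \<in> g ` carrier B \<and>
        wt ?T b' = wt ?T (g b) - simple_root D i \<and>
        eps ?T i b' = shift 1 (eps ?T i (g b)) \<and> phi ?T i b' = shift (-1) (phi ?T i (g b))) \<and>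
     (\<forall>b'\<in>carrier B. f_op ?T i (g b) = Some (g b') \<longleftrightarrow> e_op ?T i (g b') = Some (g b)) \<and>
     (phi ?T i (g b) = None \<longrightarrow> e_op ?T i (g b) = None \<and> f_op ?T i (g b) = None)"
    proof (intro conjI allI ballI impI; (elim conjE)?)
      fix b' assume "e_op ?T i (g b) = Some b'"
      then obtain b1 where "e_op B i b = Some b1" "b' = g b1" by (auto simp: s)
      then show "b' \<in> g ` carrier B" "wt ?T b' = wt ?T (g b) + simple_root D i"
        "eps ?T i b' = shift (-1) (eps ?T i (g b))" "phi ?T i b' = shift 1 (phi ?T i (g b))"
        using c(2)[of b1] by (simp_all add: s)
    next
      fix b' assume "f_op ?T i (g b) = Some b'"
      then obtain b1 where "f_op B i b = Some b1" "b' = g b1" by (auto simp: s)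
      then show "b' \<in> g ` carrier B" "wt ?T b' = wt ?T (g b) - simple_root D i"
        "eps ?T i b' = shift 1 (eps ?T i (g b))" "phi ?T i b' = shift (-1) (phi ?T i (g b))"
        using c(3)[of b1] by (simp_all add: s)
    next
      show "phi ?T i (g b) = shift (coroot D i (wt ?T (g b))) (eps ?T i (g b))"
        unfolding s by (rule c(1))
    next
      fix b' assume "b' \<in> carrier B"
      then show "f_op ?T i (g b) = Some (g b') \<longleftrightarrow> e_op ?T i (g b') = Some (g b)"
        unfolding s so by (rule c(4))
    next
      assume "phi ?T i (g b) = None"
      then show "e_op ?T i (g b) = None" "f_op ?T i (g b) = None"
        using c(5) by (simp_all add: s)
    qed
  qed
qed

lemma crystal_cellular:
  assumes "cartan_datum D" "set ws \<subseteq> index D"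
  shows "crystal D (cellular_crystal D ws)"
  using assms
proof (induction D ws rule: cellular_crystal.induct)
  case (1 D)
  have "coroot D i 0 = 0" if "i \<in> index D" for i
    using 1 that by (auto simp: cartan_datum_def intro: additive.zero)
  then show ?case by (simp add: crystal_def unit_crystal_def shift_def)
next
  case (2 D i)
  have "inj (\<lambda>n :: int. [n])" by (rule injI) simp
  with 2 show ?case by (simp add: crystal_transport crystal_elementary)
next
  case (3 D i j ws)
  have "inj (\<lambda>(n :: int, ns). n # ns)" by (rule injI) auto
  with 3 show ?case
    by (simp add: crystal_transport crystal_tensor crystal_elementary)
qed

end

(* For a weight mu put v_k(mu) = <h_{i_k}, s_{i_{k-1}} ... s_{i_1} mu>. Translation of Z^l by the
   vector v(mu) is an automorphism of the crystal graph of B_{i_1} (x) ... (x) B_{i_l}. Since the word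
   is reduced, all entries of v(rho) are positive when rho is the sum of the fundamental weights.
   Given x, start at x - N v(rho) with N large and apply e_{i_1} until the first coordinate becomes
   0; the other coordinates have then been moved by an amount independent of N. Next apply e_{i_2}
   until the second coordinate becomes 0, and so on: the coordinates that already vanish are not
   touched again, because the value of eps in the tail stays positive. Hence x - N v(rho) is connected
   to 0, and so is 0 - N v(rho); translating back, x is connected to 0. *)

theory Submission
  imports Defs
begin

section \<open>Simple reflections and words\<close>

locale cartan =
  fixes D :: "('i, 'p :: ab_group_add) cartan_datum"
  assumes datum: "cartan_datum D"
begin

abbreviation "h \<equiv> coroot D"
abbreviation "r \<equiv> simple_reflection D"
abbreviation "W \<equiv> word_prod D"
abbreviation "A \<equiv> cartan_matrix D"

sublocale zmod: module "zscale D"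
  using datum by (simp add: cartan_datum_def)

lemma additive_coroot: "i \<in> index D \<Longrightarrow> additive (h i)"
  using datum by (simp add: cartan_datum_def)

lemma coroot_add: "i \<in> index D \<Longrightarrow> h i (x + y) = h i x + h i y"
  using additive_coroot by (simp add: additive.add)

lemma coroot_diff: "i \<in> index D \<Longrightarrow> h i (x - y) = h i x - h i y"
  using additive_coroot by (simp add: additive.diff)

lemma coroot_scale:
  assumes "i \<in> index D"
  shows "h i (zscale D n x) = n * h i x"
proof -
  interpret a: additive "h i" using assms by (rule additive_coroot)
  have nat: "h i (zscale D (int k) x) = int k * h i x" for k
    by (induction k) (auto simp: a.zero a.add zmod.scale_left_distrib algebra_simps)
  show ?thesis
    by (cases n rule: int_cases2) (simp_all add: nat a.minus)
qed

lemma coroot_root: "h i (simple_root D j) = A i j"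
  by (simp add: cartan_matrix_def)

lemma coroot_fund:
  "\<lbrakk>i \<in> index D; j \<in> index D\<rbrakk> \<Longrightarrow> h j (fund D i) = (if i = j then 1 else 0)"
  using datum by (simp add: cartan_datum_def)

lemma cartan_diag: "i \<in> index D \<Longrightarrow> A i i = 2"
  using datum by (simp add: cartan_datum_def generalized_cartan_matrix_def)

lemma cartan_off_diag:
  assumes "i \<in> index D" "j \<in> index D" "i \<noteq> j"
  shows "A i j \<le> 0" "A i j = 0 \<longleftrightarrow> A j i = 0"
  using datum assms unfolding cartan_datum_def generalized_cartan_matrix_def by blast+

lemma coroot_reflection: "j \<in> index D \<Longrightarrow> h j (r i x) = h j x - h i x * A j i"
  by (simp add: simple_reflection_def coroot_diff coroot_scale coroot_root)

lemma reflection_involution [simp]: "i \<in> index D \<Longrightarrow> r i (r i x) = x"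
  by (simp add: simple_reflection_def coroot_diff coroot_scale coroot_root cartan_diag
      zmod.scale_left_diff_distrib algebra_simps)

lemma reflection_scale: "i \<in> index D \<Longrightarrow> r i (zscale D n x) = zscale D n (r i x)"
  by (simp add: simple_reflection_def coroot_scale zmod.scale_right_diff_distrib)

lemma W_Nil [simp]: "W [] x = x"
  by (simp add: word_prod_def)

lemma W_Cons [simp]: "W (i # ws) x = r i (W ws x)"
  by (simp add: word_prod_def)

lemma W_append [simp]: "W (us @ vs) x = W us (W vs x)"
  by (induction us) auto

lemma W_rev_inverse:
  assumes "set ws \<subseteq> index D"
  shows "W (rev ws) (W ws x) = x" "W ws (W (rev ws) x) = x"
  using assms by (induction ws arbitrary: x) auto

section \<open>Rank two: alternating words in two reflections\<close>

fun alt_word :: "'i \<Rightarrow> 'i \<Rightarrow> nat \<Rightarrow> 'i list" where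
  "alt_word s t 0 = []"
| "alt_word s t (Suc n) = s # alt_word t s n"

lemma length_alt_word [simp]: "length (alt_word s t n) = n"
  by (induction s t n rule: alt_word.induct) auto

lemma set_alt_word: "set (alt_word s t n) \<subseteq> {s, t}"
  by (induction s t n rule: alt_word.induct) auto

lemma alt_word_add: "\<exists>us. alt_word s t (m + n) = alt_word s t m @ us \<and> set us \<subseteq> {s, t}"
proof (induction m arbitrary: s t)
  case 0
  then show ?case using set_alt_word by auto
next
  case (Suc m)
  from Suc[of t s] show ?case by auto
qed

text \<open>Equal neighbours cancel since \<open>r i\<close> is an involution, and a word without
  equal neighbours alternates. The induction exchanges \<open>s\<close> and \<open>t\<close>: after
  a first letter \<open>t\<close>, a rest beginning with \<open>t\<close> gives the
  shortening.\<close>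

lemma dihedral_word_cases:
  assumes "set us \<subseteq> {s, t}" "set us \<subseteq> index D"
  obtains "us = alt_word t s (length us)"
  | vs where "set vs \<subseteq> {s, t}" "W vs = W us" "length vs < length us"
  | vs where "us = s # vs"
  using assms
proof (induction us arbitrary: s t thesis)
  case Nil
  then show ?case by simp
next
  case (Cons u us)
  show ?case
  proof (cases "u = s")
    case True
    then show ?thesis using Cons.prems(3) by blast
  next
    case False
    then have u: "u = t" using Cons.prems by auto
    have us: "set us \<subseteq> {t, s}" "set us \<subseteq> index D" using Cons.prems by auto
    show ?thesis
    proof (rule Cons.IH[OF _ _ _ us])
      assume "us = alt_word s t (length us)"
      then show thesis using Cons.prems(1) u by simp
    next
      fix vs assume "set vs \<subseteq> {t, s}" "W vs = W us" "length vs < length us"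
      then show thesis using Cons.prems(2)[of "u # vs"] u by (auto simp: fun_eq_iff)
    next
      fix vs assume "us = t # vs"
      then show thesis using Cons.prems(2)[of vs] Cons.prems(5) us u
        by (auto simp: fun_eq_iff)
    qed
  qed
qed

text \<open>Peeling off \<open>t\<close> and then \<open>s\<close> gives a linear recursion; the
  subtracted term arises because \<open>r s\<close> negates \<open>h s\<close>.\<close>

lemma coroot_alt_word:
  assumes "s \<in> index D" "t \<in> index D"
  shows "h s (W (alt_word t s 0) x) = h s x"
    and "h s (W (alt_word t s (Suc 0)) x) = h s x - A s t * h t x"
    and "h s (W (alt_word t s (Suc (Suc n))) x) =
      - A s t * h t (W (alt_word s t (Suc n)) x) - h s (W (alt_word t s n) x)"
  using assms by (simp_all add: coroot_reflection cartan_diag algebra_simps)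

lemma alt_word_infinite_pos:
  assumes st: "s \<in> index D" "t \<in> index D" "s \<noteq> t" and A: "A s t * A t s \<ge> 4"
    and pos: "0 < h s x" "0 < h t x"
  shows "0 < h s (W (alt_word t s n) x)"
proof -
  define F where "F n = h s (W (alt_word t s n) x)" for n
  define G where "G n = h t (W (alt_word s t n) x)" for n
  define a where "a = - A t s"
  define b where "b = - A s t"
  have "a * b \<ge> 4" using A by (simp add: a_def b_def mult.commute)
  moreover have "a \<ge> 0" "b \<ge> 0"
    using cartan_off_diag(1)[OF st] cartan_off_diag(1)[OF st(2,1)] st(3) by (auto simp: a_def b_def)
  moreover have "a \<noteq> 0" "b \<noteq> 0" using \<open>a * b \<ge> 4\<close> by auto
  ultimately have ab: "a * b \<ge> 4" "a > 0" "b > 0" by auto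
  have F: "F 0 = h s x" "F (Suc 0) = h s x + b * h t x" "F (Suc (Suc n)) = b * G (Suc n) - F n"
    and G: "G 0 = h t x" "G (Suc 0) = h t x + a * h s x" "G (Suc (Suc n)) = a * F (Suc n) - G n" for n
    using coroot_alt_word[OF st(1,2)] coroot_alt_word[OF st(2,1)]
    by (simp_all only: F_def G_def a_def b_def diff_conv_add_uminus minus_mult_left)
  \<comment> \<open>Multiplying the last two bounds by \<open>b\<close> and \<open>a\<close> and
    using \<open>a * b >= 4\<close> gives \<open>2 * F n <= b * G (Suc n)\<close>, so subtracting
    \<open>F n\<close> in the recursion costs at most half.\<close>
  have "0 < F n \<and> 0 < G n \<and> b * G n \<le> 2 * F (Suc n) \<and> a * F n \<le> 2 * G (Suc n)"
  proof (induction n)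
    case 0
    then show ?case using pos ab by (simp add: F G)
  next
    case (Suc n)
    have "0 < b * G n" "0 < a * F n" using Suc ab by simp_all
    then have p: "0 < F (Suc n)" "0 < G (Suc n)" using Suc by linarith+
    have "b * (a * F n) \<le> b * (2 * G (Suc n))" "a * (b * G n) \<le> a * (2 * F (Suc n))"
      using Suc ab by (auto intro: mult_left_mono)
    moreover have "4 * F n \<le> (a * b) * F n" "4 * G n \<le> (a * b) * G n"
      using Suc ab by (auto intro: mult_right_mono)
    ultimately have "2 * F n \<le> b * G (Suc n)" "2 * G n \<le> a * F (Suc n)"
      by (simp_all add: algebra_simps)
    then show ?case using p by (simp add: F G)
  qed
  then show ?thesis by (simp add: F_def)
qed

text \<open>In the coordinates \<open>c\<close>, \<open>d\<close> along the two roots a reflection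
  changes one coordinate only, so the braid relations become integer arithmetic. The second form
  serves \<open>r t\<close> after exchanging \<open>s\<close> and \<open>t\<close>.\<close>

lemma reflection_rank_two:
  assumes "s \<in> index D"
  shows "r s (x - zscale D c (simple_root D s) - zscale D d (simple_root D t)) =
      x - zscale D (h s x - A s t * d - c) (simple_root D s) - zscale D d (simple_root D t)"
    and "r s (x - zscale D d (simple_root D t) - zscale D c (simple_root D s)) =
      x - zscale D d (simple_root D t) - zscale D (h s x - A s t * d - c) (simple_root D s)"
proof -
  have "zscale D (c * 2) y = zscale D c y + zscale D c y" for y
    by (simp only: mult_2_right zmod.scale_left_distrib)
  with assms show "r s (x - zscale D c (simple_root D s) - zscale D d (simple_root D t)) =
      x - zscale D (h s x - A s t * d - c) (simple_root D s) - zscale D d (simple_root D t)"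
    and "r s (x - zscale D d (simple_root D t) - zscale D c (simple_root D s)) =
      x - zscale D d (simple_root D t) - zscale D (h s x - A s t * d - c) (simple_root D s)"
    by (simp_all add: simple_reflection_def coroot_add coroot_diff coroot_scale coroot_root
        cartan_diag zmod.scale_left_diff_distrib zmod.scale_left_distrib algebra_simps)
qed

lemma finite_braid:
  assumes st: "s \<in> index D" "t \<in> index D" "s \<noteq> t" and A: "A s t * A t s < 4"
  obtains m where "0 < m" "W (alt_word t s m) = W (alt_word s t m)"
    "\<And>n x. n < m \<Longrightarrow> 0 < h s x \<Longrightarrow> 0 < h t x \<Longrightarrow> 0 < h s (W (alt_word t s n) x)"
proof -
  define a where "a = - A t s"
  define b where "b = - A s t"
  have sgn: "a \<ge> 0" "b \<ge> 0" "a = 0 \<longleftrightarrow> b = 0" and ab: "a * b < 4"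
    using A cartan_off_diag[OF st] cartan_off_diag[OF st(2,1)] st(3)
    by (auto simp: a_def b_def mult.commute)
  have le: "a \<le> a * b" "b \<le> a * b" using sgn
    by (cases "a = 0"; auto simp: mult_le_cancel_left1 mult_le_cancel_right1)+
  then have "a = 0 \<or> a = 1 \<or> a = 2 \<or> a = 3" "b = 0 \<or> b = 1 \<or> b = 2 \<or> b = 3"
    using sgn ab by linarith+
  \<comment> \<open>The types A1 x A1, A2, B2 and G2, the last two in both orientations.\<close>
  then have "(a, b) \<in> {(0,0),(1,1),(1,2),(2,1),(1,3),(3,1)}"
    using sgn ab by auto
  then have Ast: "(A t s, A s t) \<in> {(0,0),(-1,-1),(-1,-2),(-2,-1),(-1,-3),(-3,-1)}"
    by (auto simp: a_def b_def)
  \<comment> \<open>The Coxeter exponent of the pair \<open>s\<close>, \<open>t\<close>.\<close>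
  define m :: nat where "m = (if A s t * A t s = 0 then 2 else if A s t * A t s = 1 then 3
      else if A s t * A t s = 2 then 4 else 6)"
  have braid: "W (alt_word t s m) = W (alt_word s t m)"
  proof
    fix x
    define R where "R c d = x - zscale D c (simple_root D s) - zscale D d (simple_root D t)" for c d
    have x: "x = R 0 0" by (simp add: R_def)
    have Rs: "r s (R c d) = R (h s x - A s t * d - c) d"
      and Rt: "r t (R c d) = R c (h t x - A t s * c - d)" for c d
      using reflection_rank_two[OF st(1)] reflection_rank_two[OF st(2)] by (simp_all add: R_def)
    have "W (alt_word t s m) (R 0 0) = W (alt_word s t m) (R 0 0)"
      using Ast by (auto simp: m_def eval_nat_numeral Rs Rt algebra_simps)
    then show "W (alt_word t s m) x = W (alt_word s t m) x" by (simp add: x[symmetric])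
  qed
  have "0 < h s (W (alt_word t s n) x)" if n: "n < m" and x: "0 < h s x" "0 < h t x" for n x
  proof -
    \<comment> \<open>A finite check remains: each value is a nonzero combination of
      \<open>h s x\<close> and \<open>h t x\<close> with nonnegative coefficients.\<close>
    have "n \<in> {0, 1, 2, 3, 4, 5}" using n by (auto simp: m_def split: if_splits)
    then show ?thesis
      using Ast n x st
      by (auto simp: m_def eval_nat_numeral coroot_reflection cartan_diag)
  qed
  then show ?thesis using braid that[of m] by (simp add: m_def)
qed

text \<open>\<open>red\<close> and \<open>up\<close> force \<open>us\<close> to alternate and not to
  begin with \<open>s\<close>. In infinite type every length is fine; in finite type the braid
  relation would rewrite a prefix of length \<open>m\<close> to begin with \<open>s\<close>,
  contrary to \<open>up\<close>, so \<open>us\<close> is shorter than \<open>m\<close>.\<close>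

lemma dihedral_pos:
  assumes st: "s \<in> index D" "t \<in> index D" "s \<noteq> t" and us: "set us \<subseteq> {s, t}"
    and pos: "0 < h s x" "0 < h t x"
    and red: "\<And>vs. set vs \<subseteq> {s, t} \<Longrightarrow> W vs = W us \<Longrightarrow> length us \<le> length vs"
    and up: "\<And>vs. set vs \<subseteq> {s, t} \<Longrightarrow> W (s # vs) = W us \<Longrightarrow> length us \<le> length vs"
  shows "0 < h s (W us x)"
proof -
  have alt: "us = alt_word t s (length us)"
  proof -
    have "set us \<subseteq> index D" using us st by auto
    with us show ?thesis
    proof (cases rule: dihedral_word_cases)
      case (2 vs)
      then show ?thesis using red[of vs] by simp
    next
      case (3 vs)
      then show ?thesis using up[of vs] us by simp
    qed
  qed
  show ?thesis
  proof (cases "A s t * A t s < 4")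
    case False
    then show ?thesis
      using alt_word_infinite_pos[OF st, of x "length us"] pos alt by simp
  next
    case True
    obtain m where m: "0 < m" "W (alt_word t s m) = W (alt_word s t m)"
      and m_pos: "\<And>n. n < m \<Longrightarrow> 0 < h s (W (alt_word t s n) x)"
      using finite_braid[OF st True] pos by metis
    show ?thesis
    proof (cases "length us < m")
      case True
      then show ?thesis using m_pos alt by metis
    next
      case False
      obtain ys where ys: "us = alt_word t s m @ ys" "set ys \<subseteq> {s, t}"
        using alt_word_add[of t s m "length us - m"] alt False by auto
      have "W us = W (alt_word s t m @ ys)"
        using ys(1) m(2) by (auto simp: fun_eq_iff)
      also have "alt_word s t m @ ys = s # (alt_word t s (m - 1) @ ys)"
        using m(1) by (cases m) auto
      finally have "W (s # (alt_word t s (m - 1) @ ys)) = W us" by (rule sym)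
      then have "length us \<le> length (alt_word t s (m - 1) @ ys)"
        using ys(2) set_alt_word[of t s "m - 1"] by (intro up) auto
      then show ?thesis using ys(1) m(1) by simp
    qed
  qed
qed

section \<open>Positivity of coroots on reduced words\<close>

text \<open>Splitting off a maximal left factor over the letters \<open>s\<close> and \<open>t\<close> reduces the claim to
  rank two.\<close>

lemma coroot_word_pos:
  assumes J: "J \<subseteq> index D" and pos: "\<And>j. j \<in> J \<Longrightarrow> 0 < h j x"
  shows "\<lbrakk>set ws \<subseteq> J; s \<in> J;
    \<And>vs. set vs \<subseteq> J \<Longrightarrow> W vs = W ws \<Longrightarrow> length ws \<le> length vs;
    \<And>vs. set vs \<subseteq> J \<Longrightarrow> W (s # vs) = W ws \<Longrightarrow> length ws \<le> length vs\<rbrakk>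
    \<Longrightarrow> 0 < h s (W ws x)"
proof (induction "length ws" arbitrary: ws s rule: less_induct)
  case less
  note ws = less.prems(1) and s = less.prems(2) and red = less.prems(3) and up = less.prems(4)
  show ?case
  proof (cases ws)
    case Nil
    then show ?thesis using s pos by simp
  next
    case (Cons t ws')
    have t: "t \<in> J" "set ws' \<subseteq> J" using ws Cons by auto
    have "s \<noteq> t" using up[of ws'] Cons t by auto
    have st: "s \<in> index D" "t \<in> index D" using s t J by auto
    \<comment> \<open>Factorizations without loss of length; a shortest \<open>vs\<close> plays the
      role of a minimal coset representative for the subgroup generated by \<open>s\<close> and
      \<open>t\<close>.\<close>
    define Q where "Q us vs \<longleftrightarrow> set us \<subseteq> {s, t} \<and> set vs \<subseteq> J \<and>
      W (us @ vs) = W ws \<and> length us + length vs = length ws" for us vs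
    have Q0: "Q [t] ws'" using Cons t by (simp add: Q_def)
    then obtain vs where vs: "\<exists>us. Q us vs"
      and min: "\<And>vs' us'. Q us' vs' \<Longrightarrow> length vs \<le> length vs'"
      using ex_has_least_nat[of "\<lambda>vs. \<exists>us. Q us vs" ws' length] by blast
    then obtain us where us: "set us \<subseteq> {s, t}" and vsJ: "set vs \<subseteq> J"
      and W: "W (us @ vs) = W ws" and len: "length us + length vs = length ws"
      by (auto simp: Q_def)
    have usJ: "set us \<subseteq> J" using us s t by auto
    have less_ws: "length vs < length ws" using min[OF Q0] Cons by simp
    have redv: "length vs \<le> length vs'" if "set vs' \<subseteq> J" "W vs' = W vs" for vs'
    proof -
      have "W (us @ vs') = W ws" using W that by (auto simp: fun_eq_iff)
      then show ?thesis using red[of "us @ vs'"] that usJ len by auto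
    qed
    have upv: "length vs \<le> length vs'"
      if "set vs' \<subseteq> J" "W (u # vs') = W vs" and u: "u \<in> {s, t}" for vs' u
    proof (rule ccontr)
      assume a: "\<not> length vs \<le> length vs'"
      have e: "W ((us @ [u]) @ vs') = W ws" using W that by (auto simp: fun_eq_iff)
      \<comment> \<open>Minimality of \<open>ws\<close> forces
        \<open>length vs' + 1 = length vs\<close>, so moving \<open>u\<close> to the left factor
        keeps the total length and contradicts the choice of \<open>vs\<close>.\<close>
      have "length ws \<le> length ((us @ [u]) @ vs')"
        by (rule red) (use e that(1) u usJ s t in auto)
      then have "Q (us @ [u]) vs'" using a e len that us by (auto simp: Q_def)
      then show False using min a by blast
    qed
    have "0 < h s (W vs x)" "0 < h t (W vs x)"
      using less.hyps[OF less_ws vsJ _ redv] upv s t by blast+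
    then have "0 < h s (W us (W vs x))"
    proof (rule dihedral_pos[OF st \<open>s \<noteq> t\<close> us])
      fix us' assume us': "set us' \<subseteq> {s, t}"
      then have us'J: "set (us' @ vs) \<subseteq> J" using s t vsJ by auto
      show "length us \<le> length us'" if "W us' = W us"
        using red[OF us'J] that W len by (auto simp: fun_eq_iff)
      show "length us \<le> length us'" if "W (s # us') = W us"
        using up[OF us'J] that W len by (auto simp: fun_eq_iff)
    qed
    then show ?thesis using W by (metis W_append)
  qed
qed

section \<open>The crystal graph of a cellular crystal\<close>

definition edges :: "'i list \<Rightarrow> (int list \<times> int list) set" where
  "edges ws = {(x, y). \<exists>i. (x, i, y) \<in> crystal_arrows D (cellular_crystal D ws)}"

definition conn :: "'i list \<Rightarrow> int list \<Rightarrow> int list \<Rightarrow> bool" where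
  "conn ws x y \<longleftrightarrow> (x, y) \<in> (edges ws \<union> (edges ws)\<inverse>)\<^sup>*"

lemma conn_refl [simp]: "conn ws x x"
  by (simp add: conn_def)

lemma conn_trans [trans]: "conn ws x y \<Longrightarrow> conn ws y z \<Longrightarrow> conn ws x z"
  unfolding conn_def by (rule rtrancl_trans)

lemma conn_sym: "conn ws x y \<Longrightarrow> conn ws y x"
  unfolding conn_def by (rule symD[OF sym_rtrancl[OF sym_Un_converse]])

lemma inv_Cons [simp]: "inv_into UNIV (\<lambda>(n, ns). n # ns) (m # x) = (m, x)"
proof -
  have "inj (\<lambda>(n :: 'a, ns). n # ns)" by (rule injI) auto
  from inv_f_f[OF this, of "(m, x)"] show ?thesis by simp
qed

lemma inv_singleton [simp]: "inv_into UNIV (\<lambda>n. [n]) [m] = m"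
  by (rule inv_f_f) (simp add: inj_def)

lemma carrier_cellular: "carrier (cellular_crystal D ws) = {x. length x = length ws}"
proof (induction D ws rule: cellular_crystal.induct)
  case (1 D)
  then show ?case by (simp add: unit_crystal_def)
next
  case (2 D i)
  then show ?case
    by (auto simp: transport_crystal_def elementary_crystal_def length_Suc_conv)
next
  case (3 D i j ws)
  then show ?case
    by (force simp: transport_crystal_def elementary_crystal_def tensor_crystal_def length_Suc_conv)
qed

lemma eps_Nil: "eps (cellular_crystal D []) j x = None"
  by (simp add: unit_crystal_def)

text \<open>\<open>eps\<close> of the unit crystal is \<open>None\<close>, neutral for
  \<open>max\<close>, so the separate clause for \<open>[i]\<close> obeys the tensor product rule as
  well and inductions need no extra case.\<close>

lemma eps_Cons:
  assumes "length x = length ws"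
  shows "eps (cellular_crystal D (i # ws)) j (n # x) =
    max (if j = i then Some (- n) else None)
      (shift (- h j (zscale D n (simple_root D i))) (eps (cellular_crystal D ws) j x))"
proof (cases ws)
  case Nil
  then show ?thesis using assms
    by (simp add: unit_crystal_def transport_crystal_def elementary_crystal_def shift_def)
next
  case (Cons k ws')
  then show ?thesis
    by (simp add: transport_crystal_def elementary_crystal_def tensor_crystal_def)
qed

lemma e_op_Cons:
  assumes "length x = length ws"
  shows "e_op (cellular_crystal D (i # ws)) j (n # x) =
    (if (if j = i then Some n else None) \<ge> eps (cellular_crystal D ws) j x
     then if j = i then Some ((n + 1) # x) else None
     else map_option ((#) n) (e_op (cellular_crystal D ws) j x))"
proof (cases ws)
  case Nil
  then show ?thesis using assms
    by (simp add: unit_crystal_def transport_crystal_def elementary_crystal_def shift_def)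
next
  case (Cons k ws')
  then show ?thesis
    by (simp add: transport_crystal_def elementary_crystal_def tensor_crystal_def
        option.map_comp comp_def)
qed

lemma eps_Cons':
  assumes "length x = length ws" "j \<in> index D"
  shows "eps (cellular_crystal D (i # ws)) j (n # x) =
    max (if j = i then Some (- n) else None)
      (shift (- (n * A j i)) (eps (cellular_crystal D ws) j x))"
  using assms by (simp add: eps_Cons coroot_scale coroot_root)

text \<open>The axiom linking the two operators lets arrows be read off \<open>e_op\<close>; only
  raising operators are computed from here on.\<close>

lemma edges_iff:
  assumes "set ws \<subseteq> index D"
  shows "(x, y) \<in> edges ws \<longleftrightarrow>
    length x = length ws \<and> length y = length ws \<and>
    (\<exists>i\<in>index D. e_op (cellular_crystal D ws) i y = Some x)"
proof -
  have "crystal D (cellular_crystal D ws)" using datum assms by (rule crystal_cellular)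
  from crystal_fe[OF this] show ?thesis
    unfolding edges_def crystal_arrows_def carrier_cellular by auto
qed

lemma conn_e_op:
  assumes "set ws \<subseteq> index D" "length x = length ws" "i \<in> index D"
    "e_op (cellular_crystal D ws) i x = Some y"
  shows "conn ws x y"
proof -
  have "crystal D (cellular_crystal D ws)" using datum assms(1) by (rule crystal_cellular)
  from crystal_e[OF this assms(3) _ assms(4)] have "length y = length ws"
    using assms(2) by (simp add: carrier_cellular)
  then have "(y, x) \<in> edges ws" using assms by (auto simp: edges_iff)
  then show ?thesis unfolding conn_def by (intro r_into_rtrancl) auto
qed

lemma e_op_exists:
  assumes "length x = length ws" "eps (cellular_crystal D ws) j x \<noteq> None"
  shows "\<exists>y. e_op (cellular_crystal D ws) j x = Some y"
  using assms
proof (induction ws arbitrary: x)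
  case Nil
  then show ?case by (simp add: eps_Nil del: cellular_crystal.simps)
next
  case (Cons i ws)
  then obtain n x' where x: "x = n # x'" "length x' = length ws" by (cases x) auto
  show ?case
  proof (cases "eps (cellular_crystal D ws) j x'")
    case None
    then have "j = i" using Cons.prems x
      by (auto simp: eps_Cons shift_def simp del: cellular_crystal.simps split: if_splits)
    then show ?thesis using None x by (simp add: e_op_Cons del: cellular_crystal.simps)
  next
    case (Some m)
    then show ?thesis using Cons.IH[OF x(2)] x by (auto simp: e_op_Cons simp del: cellular_crystal.simps)
  qed
qed

section \<open>Translations as automorphisms of the crystal graph\<close>

text \<open>The entries of \<open>coweight_vector ws \<mu>\<close> are the values of \<open>\<mu>\<close> on the coroots
  \<open>s\<^sub>1 \<dots> s\<^sub>k\<^sub>-\<^sub>1 h\<^sub>k\<close>, which are positive when the word is reduced.\<close>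

fun coweight_vector :: "'i list \<Rightarrow> 'p \<Rightarrow> int list" where
  "coweight_vector [] \<mu> = []"
| "coweight_vector (i # ws) \<mu> = h i \<mu> # coweight_vector ws (r i \<mu>)"

definition translate :: "'i list \<Rightarrow> 'p \<Rightarrow> int list \<Rightarrow> int list" where
  "translate ws \<mu> x = map2 (+) x (coweight_vector ws \<mu>)"

lemma length_coweight_vector [simp]: "length (coweight_vector ws \<mu>) = length ws"
  by (induction ws arbitrary: \<mu>) auto

lemma length_translate [simp]: "length x = length ws \<Longrightarrow> length (translate ws \<mu> x) = length ws"
  by (simp add: translate_def)

lemma translate_Nil [simp]: "translate [] \<mu> x = []"
  by (simp add: translate_def)

lemma translate_Cons [simp]:
  "translate (i # ws) \<mu> (n # x) = (n + h i \<mu>) # translate ws (r i \<mu>) x"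
  by (simp add: translate_def)

text \<open>Keeps \<open>zscale D (- N)\<close> in the form to which \<open>coroot_scale\<close> and
  \<open>reflection_scale\<close> apply.\<close>

declare zmod.scale_minus_left [simp del]

lemma translate_uminus:
  assumes "set ws \<subseteq> index D" "length x = length ws"
  shows "translate ws (zscale D N \<mu>) (translate ws (zscale D (- N) \<mu>) x) = x"
  using assms
proof (induction ws arbitrary: x \<mu>)
  case (Cons i ws)
  then show ?case by (cases x) (auto simp: coroot_scale reflection_scale)
qed simp

text \<open>Moving the first entry by \<open>h i \<mu>\<close> changes the tail contribution by
  \<open>- h i \<mu> * A j i\<close>, which cancels the correction in
  \<open>h j (r i \<mu>)\<close>.\<close>

lemma eps_translate:
  assumes "set ws \<subseteq> index D" "j \<in> index D" "length x = length ws"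
  shows "eps (cellular_crystal D ws) j (translate ws \<mu> x) =
    shift (- h j \<mu>) (eps (cellular_crystal D ws) j x)"
  using assms
proof (induction ws arbitrary: x \<mu>)
  case Nil
  then show ?case by (simp add: eps_Nil shift_def del: cellular_crystal.simps)
next
  case (Cons i ws)
  then obtain n x' where x: "x = n # x'" "length x' = length ws" by (cases x) auto
  show ?case
    using Cons x
    by (cases "eps (cellular_crystal D ws) j x'")
      (auto simp: eps_Cons' coroot_reflection cartan_diag shift_def max_def algebra_simps
        simp del: cellular_crystal.simps)
qed

text \<open>For \<open>j = i\<close> the head is compared with \<open>eps\<close> of the tail, and
  both move by \<open>h i \<mu>\<close> because \<open>h i (r i \<mu>) = - h i \<mu>\<close>, so the
  same factor is selected. For other \<open>j\<close> only finiteness of \<open>eps\<close>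
  counts.\<close>

lemma e_op_translate:
  assumes "set ws \<subseteq> index D" "j \<in> index D" "length x = length ws"
  shows "e_op (cellular_crystal D ws) j (translate ws \<mu> x) =
    map_option (translate ws \<mu>) (e_op (cellular_crystal D ws) j x)"
  using assms
proof (induction ws arbitrary: x \<mu>)
  case Nil
  then show ?case by (simp add: unit_crystal_def)
next
  case (Cons i ws)
  then obtain n x' where x: "x = n # x'" "length x' = length ws" by (cases x) auto
  show ?case
    using Cons x
    by (cases "eps (cellular_crystal D ws) j x'")
      (auto simp: e_op_Cons eps_translate coroot_reflection cartan_diag shift_def
        option.map_comp comp_def simp del: cellular_crystal.simps)
qed

lemma edges_translate:
  assumes "set ws \<subseteq> index D" "(x, y) \<in> edges ws"
  shows "(translate ws \<mu> x, translate ws \<mu> y) \<in> edges ws"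
  using assms e_op_translate[of ws _ y \<mu>] by (fastforce simp: edges_iff)

lemma conn_translate:
  assumes ws: "set ws \<subseteq> index D" and "conn ws x y"
  shows "conn ws (translate ws \<mu> x) (translate ws \<mu> y)"
  using assms(2) unfolding conn_def
proof (induction rule: rtrancl_induct)
  case (step y z)
  then have "(translate ws \<mu> y, translate ws \<mu> z) \<in> edges ws \<union> (edges ws)\<inverse>"
    using edges_translate[OF ws] by auto
  with step.IH show ?case by (rule rtrancl_into_rtrancl)
qed simp

section \<open>Leading zeros and paths to the origin\<close>

lemma eps_zeros:
  assumes "set (us @ ws) \<subseteq> index D" "j \<in> index D" "length x = length ws"
  shows "eps (cellular_crystal D ws) j x \<le>
    eps (cellular_crystal D (us @ ws)) j (replicate (length us) 0 @ x)"
  using assms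
  by (induction us) (auto simp: eps_Cons' shift_def option.map_ident le_max_iff_disj
      simp del: cellular_crystal.simps(2,3))

text \<open>A leading zero has \<open>phi\<close> equal to 0 or \<open>None\<close>, both below the
  positive \<open>eps\<close> behind it, so \<open>e_op\<close> is passed on to the tail.\<close>

lemma e_op_zeros:
  assumes "set (us @ ws) \<subseteq> index D" "j \<in> index D" "length x = length ws"
    and "Some 0 < eps (cellular_crystal D ws) j x"
  shows "e_op (cellular_crystal D (us @ ws)) j (replicate (length us) 0 @ x) =
    map_option ((@) (replicate (length us) 0)) (e_op (cellular_crystal D ws) j x)"
  using assms
proof (induction us)
  case Nil
  then show ?case by (simp add: option.map_ident)
next
  case (Cons i us)
  have "Some 0 < eps (cellular_crystal D (us @ ws)) j (replicate (length us) 0 @ x)"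
    using eps_zeros[of us ws j x] Cons.prems by auto
  then have "\<not> (if j = i then Some 0 else None) \<ge>
      eps (cellular_crystal D (us @ ws)) j (replicate (length us) 0 @ x)"
    by (auto simp: not_le intro: less_trans[of None "Some 0"])
  then show ?case
    using Cons by (simp add: e_op_Cons option.map_comp comp_def del: cellular_crystal.simps)
qed

lemma conn_zeros:
  assumes "set (us @ ws) \<subseteq> index D" "j \<in> index D" "length x = length ws"
    and "Some 0 < eps (cellular_crystal D ws) j x" "e_op (cellular_crystal D ws) j x = Some y"
  shows "conn (us @ ws) (replicate (length us) 0 @ x) (replicate (length us) 0 @ y)"
  using assms by (intro conn_e_op[of _ _ j]) (auto simp: e_op_zeros)

text \<open>While \<open>n < 0\<close> the head contributes \<open>- n > 0\<close> to
  \<open>eps\<close>, which protects the leading zeros; the bound on the tail survives raising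
  \<open>n\<close>, so \<open>e_op\<close> stays at the head.\<close>

lemma conn_climb:
  assumes us: "set (us @ i # ws) \<subseteq> index D" and x: "length x = length ws"
  shows "\<lbrakk>eps (cellular_crystal D ws) i x \<le> Some n; n \<le> 0\<rbrakk> \<Longrightarrow>
    conn (us @ i # ws) (replicate (length us) 0 @ n # x) (replicate (length us) 0 @ 0 # x)"
proof (induction "nat (- n)" arbitrary: n)
  case 0
  then show ?case by simp
next
  case (Suc k)
  have "eps (cellular_crystal D ws) i x \<le> Some (n + 1)"
    using Suc.prems(1) by (rule order_trans) simp
  then have "conn (us @ i # ws) (replicate (length us) 0 @ (n + 1) # x)
      (replicate (length us) 0 @ 0 # x)"
    using Suc by simp
  moreover have "conn (us @ i # ws) (replicate (length us) 0 @ n # x)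
      (replicate (length us) 0 @ (n + 1) # x)"
    by (rule conn_zeros[OF us, of i])
      (use us x Suc in \<open>auto simp: eps_Cons e_op_Cons less_max_iff_disj simp del: cellular_crystal.simps\<close>)
  ultimately show ?case by (meson conn_trans)
qed

text \<open>What matters is that \<open>y\<close> does not depend on \<open>\<mu>\<close>: in the argument for the remaining letters,
  \<open>\<mu>\<close> still has to be chosen large depending on \<open>y\<close>.\<close>

lemma conn_clear_head:
  assumes us: "set (us @ i # ws) \<subseteq> index D" and "length x = length ws"
  shows "\<exists>y. length y = length ws \<and> (\<forall>\<mu>. n + h i \<mu> < 0 \<longrightarrow>
    conn (us @ i # ws) (replicate (length us) 0 @ translate (i # ws) \<mu> (n # x))
      (replicate (length us) 0 @ 0 # translate ws (r i \<mu>) y))"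
  using assms(2)
\<comment> \<open>The measure counts the steps in the tail before the head takes over. If
  \<open>eps\<close> is \<open>None\<close>, no such step is made and the value of
  \<open>the\<close> is irrelevant.\<close>
proof (induction "nat (the (eps (cellular_crystal D ws) i x) - n)" arbitrary: x rule: less_induct)
  case less
  have i: "i \<in> index D" and ws: "set ws \<subseteq> index D" using us by auto
  \<comment> \<open>The head also moves by \<open>h i \<mu>\<close>, so its comparison with the
    tail, and with it the path to \<open>y\<close>, is the same for all \<mu>.\<close>
  have eps: "eps (cellular_crystal D ws) i (translate ws (r i \<mu>) x) =
      shift (h i \<mu>) (eps (cellular_crystal D ws) i x)" for \<mu>
    using i ws less.prems by (simp add: eps_translate coroot_reflection cartan_diag)
  show ?case
  proof (cases "eps (cellular_crystal D ws) i x \<le> Some n")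
    case True
    then have "eps (cellular_crystal D ws) i (translate ws (r i \<mu>) x) \<le> Some (n + h i \<mu>)" for \<mu>
      unfolding eps by (cases "eps (cellular_crystal D ws) i x") (auto simp: shift_def)
    then show ?thesis using conn_climb[OF us] less.prems by (intro exI[of _ x]) auto
  next
    case False
    then obtain m where m: "eps (cellular_crystal D ws) i x = Some m" "m > n"
      by (cases "eps (cellular_crystal D ws) i x") auto
    obtain x1 where x1: "e_op (cellular_crystal D ws) i x = Some x1"
      using e_op_exists[OF less.prems, of i] m by auto
    have "crystal D (cellular_crystal D ws)" using datum ws by (rule crystal_cellular)
    from crystal_e[OF this i _ x1]
    have l1: "length x1 = length ws" and m1: "eps (cellular_crystal D ws) i x1 = Some (m - 1)"
      using less.prems m by (auto simp: carrier_cellular shift_def)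
    obtain y where y: "length y = length ws" and
      conn_y: "\<And>\<mu>. n + h i \<mu> < 0 \<Longrightarrow>
        conn (us @ i # ws) (replicate (length us) 0 @ translate (i # ws) \<mu> (n # x1))
          (replicate (length us) 0 @ 0 # translate ws (r i \<mu>) y)"
      using less.hyps[of x1] l1 m m1 by auto
    \<comment> \<open>\<open>n + h i \<mu> < 0\<close> makes \<open>eps\<close> positive, as needed
      to pass the leading zeros.\<close>
    have "conn (us @ i # ws) (replicate (length us) 0 @ translate (i # ws) \<mu> (n # x))
        (replicate (length us) 0 @ translate (i # ws) \<mu> (n # x1))" if "n + h i \<mu> < 0" for \<mu>
      by (rule conn_zeros[OF us i])
        (use less.prems that m x1 i ws in \<open>auto simp: eps_Cons e_op_Cons eps e_op_translate
          less_max_iff_disj shift_def simp del: cellular_crystal.simps\<close>)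
    then show ?thesis using y conn_y conn_trans by blast
  qed
qed

text \<open>Induction on the letters still to be cleared, \<open>us\<close> being those already
  cleared. The remaining entries of \<open>coweight_vector\<close> belong to
  \<open>r i \<rho>\<close>, hence \<rho> is generalized.\<close>

lemma conn_origin:
  assumes "set (us @ ws) \<subseteq> index D" "length x = length ws"
    and "\<And>v. v \<in> set (coweight_vector ws \<rho>) \<Longrightarrow> 0 < v"
  shows "\<exists>N0. \<forall>N\<ge>N0. conn (us @ ws)
    (replicate (length us) 0 @ translate ws (zscale D (- N) \<rho>) x)
    (replicate (length us + length ws) 0)"
  using assms
proof (induction ws arbitrary: us x \<rho>)
  case Nil
  then show ?case by simp
next
  case (Cons i ws)
  then obtain n x' where x: "x = n # x'" "length x' = length ws" by (cases x) auto
  have i: "i \<in> index D" and v: "0 < h i \<rho>" using Cons.prems by auto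
  obtain y where y: "length y = length ws" and
    conn_y: "\<And>\<mu>. n + h i \<mu> < 0 \<Longrightarrow>
      conn (us @ i # ws) (replicate (length us) 0 @ translate (i # ws) \<mu> (n # x'))
        (replicate (length us) 0 @ 0 # translate ws (r i \<mu>) y)"
    using conn_clear_head[OF Cons.prems(1) x(2)] by blast
  \<comment> \<open>\<open>y\<close> is fixed before \<open>N\<close>, so this bound may depend on
    \<open>y\<close>.\<close>
  obtain N0 where N0: "\<And>N. N \<ge> N0 \<Longrightarrow> conn ((us @ [i]) @ ws)
      (replicate (length (us @ [i])) 0 @ translate ws (zscale D (- N) (r i \<rho>)) y)
      (replicate (length (us @ [i]) + length ws) 0)"
    using Cons.IH[of "us @ [i]" y "r i \<rho>"] Cons.prems y by auto
  have "conn (us @ i # ws) (replicate (length us) 0 @ translate (i # ws) (zscale D (- N) \<rho>) x)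
      (replicate (length us + length (i # ws)) 0)" if N: "N \<ge> max N0 (\<bar>n\<bar> + 1)" for N
  proof -
    have "N * 1 \<le> N * h i \<rho>" using N v by (intro mult_left_mono) auto
    then have "n + - N * h i \<rho> < 0" using N by (simp, linarith)
    then have "n + h i (zscale D (- N) \<rho>) < 0" using i by (simp add: coroot_scale)
    from conn_y[OF this] have "conn (us @ i # ws)
        (replicate (length us) 0 @ translate (i # ws) (zscale D (- N) \<rho>) x)
        (replicate (length us) 0 @ 0 # translate ws (zscale D (- N) (r i \<rho>)) y)"
      using x(1) i by (simp add: reflection_scale)
    also have "conn (us @ i # ws)
        (replicate (length us) 0 @ 0 # translate ws (zscale D (- N) (r i \<rho>)) y)
        (replicate (length us + length (i # ws)) 0)"
      using N0[of N] N by (simp add: replicate_app_Cons_same)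
    finally show ?thesis .
  qed
  then show ?case by blast
qed

section \<open>Positive translation vectors for reduced words\<close>

lemma coweight_vector_pos:
  assumes "\<And>us i vs. ws = us @ i # vs \<Longrightarrow> 0 < h i (W (rev us) \<rho>)"
    and "v \<in> set (coweight_vector ws \<rho>)"
  shows "0 < v"
  using assms
proof (induction ws arbitrary: \<rho>)
  case (Cons i ws)
  have "0 < h i \<rho>" using Cons.prems(1)[of "[]"] by simp
  moreover have "0 < h k (W (rev us) (r i \<rho>))" if "ws = us @ k # vs" for us k vs
    using Cons.prems(1)[of "i # us" k vs] that by simp
  ultimately show ?case using Cons.IH[of "r i \<rho>"] Cons.prems(2) by auto
qed simp

lemma W_rev_cong:
  assumes "set us \<subseteq> index D" "set vs \<subseteq> index D" "W us = W vs"
  shows "W (rev us) = W (rev vs)"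
proof
  fix x
  have "W (rev us) x = W (rev us) (W vs (W (rev vs) x))"
    using assms by (simp add: W_rev_inverse)
  also have "\<dots> = W (rev vs) x"
    unfolding assms(3)[symmetric] using assms(1) by (simp add: W_rev_inverse)
  finally show "W (rev us) x = W (rev vs) x" .
qed

lemma reduced_coweight_vector_pos:
  assumes "reduced_expression D ws w"
  shows "\<exists>\<rho>. \<forall>v\<in>set (coweight_vector ws \<rho>). 0 < v"
proof -
  \<comment> \<open>The sum runs over the letters of \<open>ws\<close> only, since the index set may
    be infinite; this is why \<open>coroot_word_pos\<close> works with a subset
    \<open>J\<close>.\<close>
  define \<rho> where "\<rho> = (\<Sum>j\<in>set ws. fund D j)"
  have ws: "set ws \<subseteq> index D"
    and red: "\<And>vs. set vs \<subseteq> index D \<Longrightarrow> W vs = W ws \<Longrightarrow> length ws \<le> length vs"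
    using assms by (auto simp: reduced_expression_def)
  have \<rho>: "0 < h j \<rho>" if j: "j \<in> set ws" for j
  proof -
    have "h j \<rho> = (\<Sum>k\<in>set ws. h j (fund D k))"
      using j ws additive.sum[OF additive_coroot] by (auto simp: \<rho>_def)
    also have "\<dots> = (\<Sum>k\<in>set ws. if k = j then 1 else 0)"
      using j ws by (intro sum.cong) (auto simp: coroot_fund subset_iff)
    also have "\<dots> = 1" using j by simp
    finally show ?thesis by simp
  qed
  have "0 < h i (W (rev us) \<rho>)" if eq: "ws = us @ i # vs" for us i vs
  proof (rule coroot_word_pos[OF ws \<rho>])
    show "set (rev us) \<subseteq> set ws" "i \<in> set ws" using eq by auto
  next
    \<comment> \<open>Reversing a shorter word for \<open>W (rev us)\<close> would shorten the
      prefix \<open>us\<close> of \<open>ws\<close>.\<close>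
    fix vs' assume vs': "set vs' \<subseteq> set ws" "W vs' = W (rev us)"
    then have "W (rev vs') = W us" using W_rev_cong[of vs' "rev us"] ws eq by auto
    then have "W (rev vs' @ i # vs) = W ws" by (auto simp: eq fun_eq_iff)
    then show "length (rev us) \<le> length vs'"
      using red[of "rev vs' @ i # vs"] vs' ws eq by auto
  next
    \<comment> \<open>Here \<open>W us\<close> has a word ending in \<open>i\<close>, which cancels
      against the next letter of \<open>ws\<close>.\<close>
    fix vs' assume vs': "set vs' \<subseteq> set ws" "W (i # vs') = W (rev us)"
    moreover have vs'D: "set vs' \<subseteq> index D" using vs'(1) ws by (rule subset_trans)
    ultimately have "W us = W (rev vs' @ [i])"
      using W_rev_cong[of "i # vs'" "rev us"] ws eq by auto
    then have "W (rev vs' @ vs) = W ws" using ws eq by (simp add: fun_eq_iff)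
    then show "length (rev us) \<le> length vs'"
      using red[of "rev vs' @ vs"] vs'D ws eq by auto
  qed
  then show ?thesis using coweight_vector_pos by blast
qed

lemma conn_cellular:
  assumes "reduced_expression D ws w" "length x = length ws"
  shows "conn ws x (replicate (length ws) 0)"
proof -
  let ?o = "replicate (length ws) 0"
  have ws: "set ws \<subseteq> index D" using assms by (simp add: reduced_expression_def)
  obtain \<rho> where \<rho>: "\<And>v. v \<in> set (coweight_vector ws \<rho>) \<Longrightarrow> 0 < v"
    using reduced_coweight_vector_pos[OF assms(1)] by blast
  have far: "\<exists>N0. \<forall>N\<ge>N0. conn ws (translate ws (zscale D (- N) \<rho>) y) ?o"
    if "length y = length ws" for y
    using conn_origin[of "[]" ws y \<rho>] ws that \<rho> by simp
  \<comment> \<open>A common \<open>N\<close> for \<open>x\<close> and the origin allows one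
    translation to be undone at both ends.\<close>
  obtain N1 N2 where "\<And>N. N \<ge> N1 \<Longrightarrow> conn ws (translate ws (zscale D (- N) \<rho>) x) ?o"
    and "\<And>N. N \<ge> N2 \<Longrightarrow> conn ws (translate ws (zscale D (- N) \<rho>) ?o) ?o"
    using far[OF assms(2)] far[of ?o] by auto
  then obtain N where "conn ws (translate ws (zscale D (- N) \<rho>) x) ?o"
    and "conn ws (translate ws (zscale D (- N) \<rho>) ?o) ?o"
    by (meson max.cobounded1 max.cobounded2)
  then have "conn ws (translate ws (zscale D (- N) \<rho>) x) (translate ws (zscale D (- N) \<rho>) ?o)"
    by (meson conn_sym conn_trans)
  from conn_translate[OF ws this, of "zscale D N \<rho>"] show ?thesis
    using assms(2) ws by (simp add: translate_uminus)
qed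

end

theorem theorem9p4:
  fixes D :: "('i, 'p :: ab_group_add) cartan_datum"
    and w :: "'p \<Rightarrow> 'p"
    and ws :: "'i list"
  assumes "cartan_datum D"
    and "w \<in> weyl_group D"
    and "reduced_expression D ws w"
  shows "crystal_connected D (cellular_crystal D ws)"
proof -
  interpret cartan D by unfold_locales (rule assms(1))
  have "conn ws x y" if "length x = length ws" "length y = length ws" for x y
    using conn_cellular[OF assms(3)] that by (meson conn_sym conn_trans)
  then show ?thesis
    by (simp add: crystal_connected_def carrier_cellular conn_def edges_def)
qed

end
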